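(* Let $n\geq 1$ and let $X^n=(X_k)_{k=1}^n$ be the first $n$ steps of a (time-homogeneous) Markov chain on some set $\mathcal{X}\subset\mathbb{R}$, started from some deterministic $X_0=x_0\in\mathcal{X}$. Assume $\mathcal{X}$ is countable and locally finite, and let $\boldsymbol{p}=(p_{x,y})_{x,y\in\mathcal{X}}$ denote the transition kernel of the chain. Let $A\subset\mathcal{X}^n$, and assume the following: (H1) for all $k\in\{0,\ldots,n-1\}$, $\boldsymbol{p}$ has $\mathrm{Supp}(\mathbf{P}_{X_k})$-unfavorable crossings; (H2) $\mathbf{P}_{X^n}(A)>0$ and $A$ is max/min-stable. Then the conditional law $\mathbf{P}_{X^n}(\cdot\,|\,A)$ is positively associated in $\mathbb{R}^n$.
   Context: $\mathbf{P}_Z$ denotes the law of a random variable $Z$; for a probability measure $\mathbf{P}$ and an event $A$ with $\mathbf{P}(A)>0$, $\mathbf{P}(B|A)=\mathbf{P}(B\cap A)/\mathbf{P}(A)$. $\mathrm{Supp}(\mathbf{P}_{X_k})$ is the set of points $x\in\mathcal{X}$ with $\mathbf{P}(X_k=x)>0$. $\mathbb{R}^n$ is endowed with its Borel $\sigma$-algebra and the product partial order: $u\preceq v$ iff $u_i\leq v_i$ for all $i$. $u\vee v$ and $u\wedge v$ denote the least upper bound and greatest lower bound (coordinatewise maximum and minimum). A set $A$ is max/min-stable if $u,v\in A$ implies $u\vee v\in A$ and $u\wedge v\in A$. Unfavorable crossings: let $\boldsymbol{p}=(p_{x,y})_{x,y\in\mathcal{X}}$ be a probability transition kernel on a countable set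 $\mathcal{X}\subset\mathbb{R}$ (i.e. $p_{x,y}\geq 0$ and $\sum_y p_{x,y}=1$ for all $x\in\mathcal{X}$), and let $\mathcal{X}_1\subset\mathcal{X}$. We say that $\boldsymbol{p}$ has $\mathcal{X}_1$-unfavorable crossings if for all $u_1,v_1\in\mathcal{X}_1$ and $u_2,v_2\in\mathcal{X}$, $$p_{u_1,u_2}\,p_{v_1,v_2}\;\leq\; p_{u_1\vee v_1,\,u_2\vee v_2}\;p_{u_1\wedge v_1,\,u_2\wedge v_2}.$$ A function $f:\mathbb{R}^n\to\mathbb{R}$ is increasing if $u\preceq v$ implies $f(u)\leq f(v)$. A probability measure $\mathbf{P}$ on $\mathbb{R}^n$ is positively associated if, for $Z\sim\mathbf{P}$ and all increasing functions $f,g\in L^2(\mathbf{P})$, $\mathbf{E}[f(Z)g(Z)]\geq\mathbf{E}[f(Z)]\,\mathbf{E}[g(Z)]$. *)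

theory Defs
  imports "HOL-Probability.Probability"
begin

definition transition_kernel :: "real set \<Rightarrow> (real \<Rightarrow> real \<Rightarrow> real) \<Rightarrow> bool" where
  "transition_kernel S p \<longleftrightarrow>
     (\<forall>x\<in>S. (\<forall>y\<in>S. 0 \<le> p x y) \<and> ((\<lambda>y. p x y) has_sum 1) S)"

text \<open>The values of \<^term>\<open>p\<close> outside \<^term>\<open>S\<close> are never used.  The path \<^term>\<open>x\<close> in the
  Markov property ranges over all sequences, but only \<open>x 0, \<dots>, x k\<close> matter.\<close>

locale homogeneous_markov_chain = prob_space M
  for M :: "'a measure" +
  fixes S :: "real set"
    and p :: "real \<Rightarrow> real \<Rightarrow> real"
    and x0 :: real
    and X :: "nat \<Rightarrow> 'a \<Rightarrow> real"
  assumes kernel: "transition_kernel S p"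
    and start_in: "x0 \<in> S"
    and measurable_step: "\<And>k. X k \<in> borel_measurable M"
    and step_in: "\<And>k \<omega>. \<omega> \<in> space M \<Longrightarrow> X k \<omega> \<in> S"
    and start: "AE \<omega> in M. X 0 \<omega> = x0"
    and markov: "\<And>k x y. y \<in> S \<Longrightarrow> \<P>(\<omega> in M. \<forall>i\<le>k. X i \<omega> = x i) > 0 \<Longrightarrow>
           \<P>(\<omega> in M. X (Suc k) \<omega> = y \<bar> (\<forall>i\<le>k. X i \<omega> = x i)) = p (x k) y"

definition locally_finite_set :: "real set \<Rightarrow> bool" where
  "locally_finite_set S \<longleftrightarrow> (\<forall>B. bounded B \<longrightarrow> finite (S \<inter> B))"

definition law_supp :: "real set \<Rightarrow> real measure \<Rightarrow> real set" where
  "law_supp S P = {x \<in> S. measure P {x} > 0}"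

definition unfavorable_crossings ::
  "real set \<Rightarrow> (real \<Rightarrow> real \<Rightarrow> real) \<Rightarrow> real set \<Rightarrow> bool" where
  "unfavorable_crossings S p S1 \<longleftrightarrow>
     (\<forall>u1\<in>S1. \<forall>v1\<in>S1. \<forall>u2\<in>S. \<forall>v2\<in>S.
        p u1 u2 * p v1 v2 \<le> p (max u1 v1) (max u2 v2) * p (min u1 v1) (min u2 v2))"

text \<open>A vector in $n$-dimensional space is an extensional function on \<open>{1..n}\<close>, that is, a point
  of \<open>{1..n} \<rightarrow>\<^sub>E UNIV\<close>.  Two such functions agree outside \<open>{1..n}\<close>, so the pointwise
  \<open>\<le>\<close>, \<open>sup\<close> and \<open>inf\<close> of the function type are exactly the product order and the
  coordinatewise maximum and minimum.  The finite product sigma-algebra below is the Borel one.\<close>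

definition Rn :: "nat \<Rightarrow> (nat \<Rightarrow> real) measure" where
  "Rn n = (\<Pi>\<^sub>M i\<in>{1..n}. borel)"

definition path_law :: "'a measure \<Rightarrow> (nat \<Rightarrow> 'a \<Rightarrow> real) \<Rightarrow> nat \<Rightarrow> (nat \<Rightarrow> real) measure" where
  "path_law M X n = distr M (Rn n) (\<lambda>\<omega>. \<lambda>k\<in>{1..n}. X k \<omega>)"

definition max_min_stable :: "(nat \<Rightarrow> real) set \<Rightarrow> bool" where
  "max_min_stable A \<longleftrightarrow> (\<forall>u\<in>A. \<forall>v\<in>A. sup u v \<in> A \<and> inf u v \<in> A)"

definition positively_associated :: "nat \<Rightarrow> (nat \<Rightarrow> real) measure \<Rightarrow> bool" where
  "positively_associated n P \<longleftrightarrow>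
     prob_space P \<and> sets P = sets (Rn n) \<and>
     (\<forall>f g :: (nat \<Rightarrow> real) \<Rightarrow> real. mono_on (space (Rn n)) f \<longrightarrow> mono_on (space (Rn n)) g \<longrightarrow>
        f \<in> borel_measurable P \<longrightarrow> integrable P (\<lambda>z. (f z)\<^sup>2) \<longrightarrow>
        g \<in> borel_measurable P \<longrightarrow> integrable P (\<lambda>z. (g z)\<^sup>2) \<longrightarrow>
        (\<integral>z. f z * g z \<partial>P) \<ge> (\<integral>z. f z \<partial>P) * (\<integral>z. g z \<partial>P))"

text \<open>The library's \<^const>\<open>uniform_measure\<close> of an arbitrary measure \<open>P\<close> and an event \<open>A\<close> is the
  conditional measure \<open>B \<mapsto> P (A \<inter> B) / P A\<close>; nothing about it is specific to uniform laws.\<close>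

abbreviation conditional_law :: "'b measure \<Rightarrow> 'b set \<Rightarrow> 'b measure" where
  "conditional_law P A \<equiv> uniform_measure P A"

end

theory Submission imports Defs begin

text \<open>
  The law of the conditioned path is an atomic measure on the lattice \<open>S\<^sup>n\<close>, and positive
  association is the FKG inequality for it.  So two things have to be seen: that this measure is
  log-supermodular, \<open>\<mu>(u) \<mu>(v) \<le> \<mu>(u \<squnion> v) \<mu>(u \<sqinter> v)\<close>, and that FKG holds for log-supermodular
  measures carried by \<open>S\<^sup>n\<close>.

  For the first, a path \<open>z\<close> has probability \<open>p(x\<^sub>0, z\<^sub>1) p(z\<^sub>1, z\<^sub>2) \<dots> p(z\<^bsub>n-1\<^esub>, z\<^sub>n)\<close>, and
  the inequality of unfavorable crossings is the required inequality for a single factor; it may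
  be used at step \<open>k\<close> because a path of positive probability visits only points of the support of
  \<open>X\<^sub>k\<close>, while a path of probability zero makes the left-hand side vanish
  (\<open>path_weight_supermodular\<close>).  Conditioning on \<open>A\<close> multiplies this weight by the indicator of
  \<open>A\<close>, up to a constant, and for a max/min-stable set the indicator is itself log-supermodular.

  For the second, \<open>FKG_finite\<close> derives the FKG inequality on a finite product of finite chains
  from the four functions theorem of Ahlswede and Daykin (\<open>four_functions_product\<close>).  On a product
  of chains that theorem follows by summing out one coordinate at a time, so that only the case of
  a single chain needs an argument, which is an elementary inequality between four numbers.
  Local finiteness makes the boxes \<open>(S \<inter> [-N, N])\<^sup>n\<close> finite sublattices exhausting \<open>S\<^sup>n\<close>; since
  a restriction of a log-supermodular weight to a sublattice is log-supermodular, FKG holds on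
  each box, and dominated convergence passes to the limit (\<open>FKG_locally_finite\<close>).
\<close>

section \<open>The four functions theorem on finite products of chains\<close>

text \<open>Multiplied by \<open>c\<close>, the claim is \<open>0 \<le> (c - a) * (c - b)\<close> combined with \<open>a * b \<le> c * d\<close>.\<close>

lemma sum_le_if_products_dominated:
  fixes a b c d :: real
  assumes "0 \<le> c" "0 \<le> d" "a \<le> c" "b \<le> c" "a * b \<le> c * d"
  shows "a + b \<le> c + d"
proof (cases "c = 0")
  case True
  then show ?thesis using assms by simp
next
  case False
  have "0 \<le> (c - a) * (c - b)"
    using assms by simp
  with assms(5) have "c * (a + b) \<le> c * (c + d)"
    by (simp add: algebra_simps)
  then show ?thesis
    using False assms(1) by simp
qed

text \<open>On a chain, \<open>x \<squnion> y\<close> and \<open>x \<sqinter> y\<close> are \<open>x\<close> and \<open>y\<close> in some order, so both mixed terms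
  \<open>f1 x * f2 y\<close> and \<open>f1 y * f2 x\<close> are bounded by the same product, while the hypothesis at the
  diagonal pairs \<open>(x, x)\<close> and \<open>(y, y)\<close> controls the product of the mixed terms.  By
  \<open>sum_le_if_products_dominated\<close> the desired inequality then holds for each unordered pair
  \<open>{x, y}\<close>, and twice the double sum is the sum over such symmetrised pairs.\<close>

lemma four_functions_chain:
  fixes f1 f2 f3 f4 :: "'a::{linorder,lattice} \<Rightarrow> real"
  assumes nonneg: "\<And>x. x \<in> T \<Longrightarrow> 0 \<le> f1 x" "\<And>x. x \<in> T \<Longrightarrow> 0 \<le> f2 x"
      "\<And>x. x \<in> T \<Longrightarrow> 0 \<le> f3 x" "\<And>x. x \<in> T \<Longrightarrow> 0 \<le> f4 x"
    and dom: "\<And>x y. x \<in> T \<Longrightarrow> y \<in> T \<Longrightarrow> f1 x * f2 y \<le> f3 (sup x y) * f4 (inf x y)"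
  shows "sum f1 T * sum f2 T \<le> sum f3 T * sum f4 T"
proof -
  let ?F = "\<lambda>x y. f1 x * f2 y" and ?G = "\<lambda>x y. f3 x * f4 y"
  have ordered: "?F x y + ?F y x \<le> ?G x y + ?G y x" if "x \<in> T" "y \<in> T" "x \<le> y" for x y
  proof -
    have sup_inf: "sup x y = y" "inf x y = x" "sup y x = y" "inf y x = x"
      using that by (auto simp: sup.absorb2 inf.absorb1 sup.absorb1 inf.absorb2)
    have diag: "?F x x \<le> ?G x x" "?F y y \<le> ?G y y"
      using dom[of x x] dom[of y y] that by auto
    have "?F x y * ?F y x = ?F x x * ?F y y" by simp
    also have "\<dots> \<le> ?G x x * ?G y y"
      using that nonneg by (intro mult_mono[OF diag]) auto
    also have "\<dots> = ?G y x * ?G x y" by simp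
    finally have "?F x y * ?F y x \<le> ?G y x * ?G x y" .
    then have "?F x y + ?F y x \<le> ?G y x + ?G x y"
      using dom[of x y] dom[of y x] that nonneg
      by (intro sum_le_if_products_dominated) (auto simp: sup_inf)
    then show ?thesis by simp
  qed
  have pair: "?F x y + ?F y x \<le> ?G x y + ?G y x" if "x \<in> T" "y \<in> T" for x y
    using ordered[of x y] ordered[of y x] that by (cases "x \<le> y") (auto simp: add.commute)
  have symm: "2 * (sum g T * sum h T) = (\<Sum>x\<in>T. \<Sum>y\<in>T. g x * h y + g y * h x)"
    for g h :: "'a \<Rightarrow> real"
  proof -
    have "(\<Sum>x\<in>T. \<Sum>y\<in>T. g y * h x) = (\<Sum>x\<in>T. \<Sum>y\<in>T. g x * h y)"
      by (rule sum.swap)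
    then show ?thesis
      by (simp add: sum.distrib sum_product)
  qed
  have "2 * (sum f1 T * sum f2 T) \<le> 2 * (sum f3 T * sum f4 T)"
    unfolding symm by (intro sum_mono pair)
  then show ?thesis by simp
qed

lemma sum_PiE_insert:
  assumes "i \<notin> I"
  shows "sum h (Pi\<^sub>E (insert i I) T) = (\<Sum>z\<in>Pi\<^sub>E I T. \<Sum>x\<in>T i. h (z(i := x)))"
proof -
  have "sum h (Pi\<^sub>E (insert i I) T) = (\<Sum>(x, z)\<in>T i \<times> Pi\<^sub>E I T. h (z(i := x)))"
    unfolding PiE_insert_eq
    by (subst sum.reindex[OF inj_combinator[OF assms]]) (simp add: o_def case_prod_unfold)
  also have "\<dots> = (\<Sum>x\<in>T i. \<Sum>z\<in>Pi\<^sub>E I T. h (z(i := x)))"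
    by (simp add: sum.cartesian_product)
  also have "\<dots> = (\<Sum>z\<in>Pi\<^sub>E I T. \<Sum>x\<in>T i. h (z(i := x)))"
    by (rule sum.swap)
  finally show ?thesis .
qed

lemma sup_inf_in_PiE_chains:
  fixes u v :: "'i \<Rightarrow> 'a::{linorder,lattice}"
  assumes "u \<in> Pi\<^sub>E I T" "v \<in> Pi\<^sub>E I T"
  shows "sup u v \<in> Pi\<^sub>E I T" "inf u v \<in> Pi\<^sub>E I T"
  using assms by (auto simp: PiE_iff extensional_def sup_max inf_min max_def min_def)

lemma sup_inf_fun_upd:
  fixes u v :: "'i \<Rightarrow> 'a::lattice"
  shows "sup (u(i := x)) (v(i := y)) = (sup u v)(i := sup x y)"
    and "inf (u(i := x)) (v(i := y)) = (inf u v)(i := inf x y)"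
  by auto

text \<open>The chain case, applied in coordinate \<open>i\<close> for fixed \<open>u\<close> and \<open>v\<close> on the remaining coordinates,
  says that the four marginals obtained by summing out coordinate \<open>i\<close> satisfy the hypothesis
  again.  The induction must therefore range over all quadruples of functions.\<close>

theorem four_functions_product:
  fixes f1 f2 f3 f4 :: "('i \<Rightarrow> 'a::{linorder,lattice}) \<Rightarrow> real"
  assumes "finite I"
    and "\<And>z. z \<in> Pi\<^sub>E I T \<Longrightarrow> 0 \<le> f1 z" "\<And>z. z \<in> Pi\<^sub>E I T \<Longrightarrow> 0 \<le> f2 z"
      "\<And>z. z \<in> Pi\<^sub>E I T \<Longrightarrow> 0 \<le> f3 z" "\<And>z. z \<in> Pi\<^sub>E I T \<Longrightarrow> 0 \<le> f4 z"
    and "\<And>u v. u \<in> Pi\<^sub>E I T \<Longrightarrow> v \<in> Pi\<^sub>E I T \<Longrightarrow> f1 u * f2 v \<le> f3 (sup u v) * f4 (inf u v)"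
  shows "sum f1 (Pi\<^sub>E I T) * sum f2 (Pi\<^sub>E I T) \<le> sum f3 (Pi\<^sub>E I T) * sum f4 (Pi\<^sub>E I T)"
  using assms
proof (induction I arbitrary: f1 f2 f3 f4 rule: finite_induct)
  case empty
  have "sup (\<lambda>_. undefined) (\<lambda>_. undefined) = (\<lambda>_::'i. undefined::'a)"
    "inf (\<lambda>_. undefined) (\<lambda>_. undefined) = (\<lambda>_::'i. undefined::'a)"
    by auto
  then show ?case using empty(5)[of "\<lambda>_. undefined" "\<lambda>_. undefined"] by simp
next
  case (insert i I)
  have upd: "z(i := x) \<in> Pi\<^sub>E (insert i I) T" if "z \<in> Pi\<^sub>E I T" "x \<in> T i" for z x
    using that by (auto simp: PiE_insert_eq)
  show ?case
    unfolding sum_PiE_insert[OF insert.hyps(2)]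
  proof (rule insert.IH)
    fix u v assume uv: "u \<in> Pi\<^sub>E I T" "v \<in> Pi\<^sub>E I T"
    note si = sup_inf_in_PiE_chains[OF uv]
    show "(\<Sum>x\<in>T i. f1 (u(i := x))) * (\<Sum>x\<in>T i. f2 (v(i := x)))
        \<le> (\<Sum>x\<in>T i. f3 ((sup u v)(i := x))) * (\<Sum>x\<in>T i. f4 ((inf u v)(i := x)))"
    proof (rule four_functions_chain)
      fix x y assume xy: "x \<in> T i" "y \<in> T i"
      show "f1 (u(i := x)) * f2 (v(i := y))
          \<le> f3 ((sup u v)(i := sup x y)) * f4 ((inf u v)(i := inf x y))"
        using insert.prems(5)[OF upd[OF uv(1) xy(1)] upd[OF uv(2) xy(2)]]
        by (simp only: sup_inf_fun_upd)
    qed (intro insert.prems(1-4) upd uv si; assumption)+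
  qed (intro sum_nonneg insert.prems(1-4) upd; assumption)+
qed

section \<open>The FKG inequality\<close>

text \<open>For \<open>f, g \<ge> 0\<close> this is the four functions theorem with \<open>\<mu> f\<close>, \<open>\<mu> g\<close>, \<open>\<mu> f g\<close> and \<open>\<mu>\<close>, because
  monotonicity gives \<open>f(u) g(v) \<le> f(u \<squnion> v) g(u \<squnion> v)\<close>.  The general case reduces to it by
  adding a large constant to \<open>f\<close> and \<open>g\<close>, which changes both sides by the same amount.\<close>

theorem FKG_finite:
  fixes \<mu> f g :: "('i \<Rightarrow> 'a::{linorder,lattice}) \<Rightarrow> real"
  assumes fin: "finite I" "\<And>i. i \<in> I \<Longrightarrow> finite (T i)"
    and nonneg: "\<And>z. z \<in> Pi\<^sub>E I T \<Longrightarrow> 0 \<le> \<mu> z"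
    and supermodular: "\<And>u v. u \<in> Pi\<^sub>E I T \<Longrightarrow> v \<in> Pi\<^sub>E I T \<Longrightarrow>
          \<mu> u * \<mu> v \<le> \<mu> (sup u v) * \<mu> (inf u v)"
    and mono: "mono_on (Pi\<^sub>E I T) f" "mono_on (Pi\<^sub>E I T) g"
  shows "(\<Sum>z\<in>Pi\<^sub>E I T. \<mu> z * f z) * (\<Sum>z\<in>Pi\<^sub>E I T. \<mu> z * g z)
       \<le> (\<Sum>z\<in>Pi\<^sub>E I T. \<mu> z * (f z * g z)) * (\<Sum>z\<in>Pi\<^sub>E I T. \<mu> z)"
proof -
  let ?L = "Pi\<^sub>E I T"
  define c where "c = (\<Sum>z\<in>?L. \<bar>f z\<bar> + \<bar>g z\<bar>)"
  have finL: "finite ?L" using fin by (rule finite_PiE)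
  have bound: "\<bar>f z\<bar> + \<bar>g z\<bar> \<le> c" if "z \<in> ?L" for z
    unfolding c_def using finL that by (intro member_le_sum) auto
  let ?f = "\<lambda>z. f z + c" and ?g = "\<lambda>z. g z + c"
  have pos: "0 \<le> ?f z" "0 \<le> ?g z" if "z \<in> ?L" for z
    using bound[OF that] by linarith+
  have "(\<Sum>z\<in>?L. \<mu> z * ?f z) * (\<Sum>z\<in>?L. \<mu> z * ?g z)
      \<le> (\<Sum>z\<in>?L. \<mu> z * (?f z * ?g z)) * (\<Sum>z\<in>?L. \<mu> z)"
  proof (rule four_functions_product[OF fin(1)])
    fix u v assume uv: "u \<in> ?L" "v \<in> ?L"
    note si = sup_inf_in_PiE_chains[OF uv]
    have "?f u \<le> ?f (sup u v)" "?g v \<le> ?g (sup u v)"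
      using mono_onD[OF mono(1) uv(1) si(1)] mono_onD[OF mono(2) uv(2) si(1)] by auto
    then have fg: "?f u * ?g v \<le> ?f (sup u v) * ?g (sup u v)"
      using uv si pos by (intro mult_mono) auto
    have "(\<mu> u * \<mu> v) * (?f u * ?g v)
        \<le> (\<mu> (sup u v) * \<mu> (inf u v)) * (?f (sup u v) * ?g (sup u v))"
      using uv si nonneg pos by (intro mult_mono supermodular fg mult_nonneg_nonneg) auto
    then show "\<mu> u * ?f u * (\<mu> v * ?g v)
        \<le> \<mu> (sup u v) * (?f (sup u v) * ?g (sup u v)) * \<mu> (inf u v)"
      by (simp add: mult_ac)
  qed (use nonneg pos in auto)
  moreover have "(\<Sum>z\<in>?L. \<mu> z * ?f z) = (\<Sum>z\<in>?L. \<mu> z * f z) + c * sum \<mu> ?L"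
    "(\<Sum>z\<in>?L. \<mu> z * ?g z) = (\<Sum>z\<in>?L. \<mu> z * g z) + c * sum \<mu> ?L"
    "(\<Sum>z\<in>?L. \<mu> z * (?f z * ?g z)) = (\<Sum>z\<in>?L. \<mu> z * (f z * g z))
       + c * (\<Sum>z\<in>?L. \<mu> z * f z) + c * (\<Sum>z\<in>?L. \<mu> z * g z) + c * c * sum \<mu> ?L"
    by (simp_all add: sum_distrib_left algebra_simps sum.distrib)
  ultimately show ?thesis
    by (simp add: algebra_simps)
qed

lemma integral_indicator_finite:
  fixes h :: "'b \<Rightarrow> real"
  assumes "finite_measure M" "finite F" "\<And>z. z \<in> F \<Longrightarrow> {z} \<in> sets M"
  shows "(\<integral>z. indicator F z * h z \<partial>M) = (\<Sum>z\<in>F. measure M {z} * h z)"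
proof -
  interpret finite_measure M by fact
  have "(\<lambda>z. indicator F z * h z) = (\<lambda>z. \<Sum>a\<in>F. h a * indicator {a} z)"
  proof
    fix z
    have "(\<Sum>a\<in>F. h a * indicator {a} z) = (\<Sum>a\<in>F. if a = z then h z else 0)"
      by (intro sum.cong) (auto simp: indicator_def)
    then show "indicator F z * h z = (\<Sum>a\<in>F. h a * indicator {a} z)"
      using assms(2) by (simp add: indicator_def)
  qed
  moreover have "(\<integral>z. (\<Sum>a\<in>F. h a * indicator {a} z) \<partial>M) = (\<Sum>a\<in>F. h a * measure M {a})"
    using assms(3) sets.sets_into_space[OF assms(3)]
    by (subst Bochner_Integration.integral_sum) (auto intro!: sum.cong simp: Int_absorb1 emeasure_eq_measure)
  ultimately show ?thesis by (simp add: mult.commute)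
qed

lemma space_Rn: "space (Rn n) = {1..n} \<rightarrow>\<^sub>E UNIV"
  by (simp add: Rn_def space_PiM)

lemma singleton_in_Rn:
  assumes "z \<in> {1..n} \<rightarrow>\<^sub>E UNIV"
  shows "{z} \<in> sets (Rn n)"
proof -
  have "{z} = Pi\<^sub>E {1..n} (\<lambda>i. {z i})"
    using assms by (simp add: PiE_singleton PiE_iff)
  also have "\<dots> \<in> sets (Rn n)"
    unfolding Rn_def by (intro sets_PiM_I_finite) auto
  finally show ?thesis .
qed

text \<open>The factor \<open>sum \<mu>\<close> in \<open>FKG_finite\<close>, which is the mass of the box, allows the restricted measures
  to be used without normalisation; in the limit it becomes the total mass 1.  Square
  integrability of \<open>f\<close> and \<open>g\<close> enters only to make \<open>f\<close>, \<open>g\<close> and \<open>f * g\<close> integrable, so that each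
  of them dominates its own truncations.\<close>

theorem FKG_locally_finite:
  assumes P: "prob_space P" "sets P = sets (Rn n)"
    and S: "locally_finite_set S"
    and carried: "AE z in P. z \<in> {1..n} \<rightarrow>\<^sub>E S"
    and supermodular: "\<And>u v. u \<in> {1..n} \<rightarrow>\<^sub>E S \<Longrightarrow> v \<in> {1..n} \<rightarrow>\<^sub>E S \<Longrightarrow>
       measure P {u} * measure P {v} \<le> measure P {sup u v} * measure P {inf u v}"
  shows "positively_associated n P"
  unfolding positively_associated_def
proof (intro conjI allI impI P)
  fix f g :: "(nat \<Rightarrow> real) \<Rightarrow> real"
  assume mono: "mono_on (space (Rn n)) f" "mono_on (space (Rn n)) g"
    and [measurable]: "f \<in> borel_measurable P" "g \<in> borel_measurable P"
    and sq: "integrable P (\<lambda>z. (f z)\<^sup>2)" "integrable P (\<lambda>z. (g z)\<^sup>2)"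
  interpret prob_space P by fact
  define T where "T N = S \<inter> {- real N..real N}" for N :: nat
  define F where "F N = {1..n} \<rightarrow>\<^sub>E T N" for N
  have finT: "finite (T N)" for N
    using S unfolding locally_finite_set_def T_def by auto
  then have finF: "finite (F N)" for N
    unfolding F_def by (auto intro: finite_PiE)
  have F_sub: "F N \<subseteq> {1..n} \<rightarrow>\<^sub>E S" "F N \<subseteq> space (Rn n)" for N
    unfolding F_def T_def space_Rn by (auto simp: PiE_iff)
  have sing: "{z} \<in> sets P" if "z \<in> F N" for z N
    using subsetD[OF F_sub(2) that] unfolding P(2) space_Rn by (rule singleton_in_Rn)
  have F_meas: "F N \<in> sets P" for N
    using sets.finite_UN[OF finF[of N], of "\<lambda>z. {z}"] sing by simp
  have exhaust: "\<forall>\<^sub>F N in sequentially. z \<in> F N" if "z \<in> {1..n} \<rightarrow>\<^sub>E S" for z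
  proof -
    have "\<forall>\<^sub>F N in sequentially. \<bar>z i\<bar> \<le> real N" for i
      using eventually_ge_at_top[of "nat \<lceil>\<bar>z i\<bar>\<rceil>"] by eventually_elim linarith
    then have "\<forall>\<^sub>F N in sequentially. \<forall>i\<in>{1..n}. \<bar>z i\<bar> \<le> real N"
      by (intro eventually_ball_finite) auto
    then show ?thesis
    proof eventually_elim
      case (elim N)
      then show ?case
        using that by (fastforce simp: F_def T_def PiE_iff abs_le_iff)
    qed
  qed
  have lim: "(\<lambda>N. \<Sum>z\<in>F N. measure P {z} * h z) \<longlonglongrightarrow> (\<integral>z. h z \<partial>P)"
    if h: "integrable P h" for h
  proof -
    have "(\<lambda>N. \<integral>z. indicator (F N) z * h z \<partial>P) \<longlonglongrightarrow> (\<integral>z. h z \<partial>P)"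
    proof (rule integral_dominated_convergence[where w = "\<lambda>z. \<bar>h z\<bar>"])
      show "AE z in P. (\<lambda>N. indicator (F N) z * h z) \<longlonglongrightarrow> h z"
        using carried
      proof eventually_elim
        case (elim z)
        then show ?case
          by (intro tendsto_eventually eventually_mono[OF exhaust]) auto
      qed
    qed (use h F_meas in \<open>auto simp: indicator_def\<close>)
    moreover have "(\<integral>z. indicator (F N) z * h z \<partial>P) = (\<Sum>z\<in>F N. measure P {z} * h z)" for N
      using sing by (intro integral_indicator_finite finF finite_measure_axioms) auto
    ultimately show ?thesis by simp
  qed
  have int: "integrable P f" "integrable P g"
    using sq by (auto intro: square_integrable_imp_integrable)
  have int_fg: "integrable P (\<lambda>z. f z * g z)"
  proof (rule Bochner_Integration.integrable_bound)
    show "integrable P (\<lambda>z. (f z)\<^sup>2 + (g z)\<^sup>2)"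
      using sq by simp
    have "\<bar>a * b\<bar> \<le> a\<^sup>2 + b\<^sup>2" for a b :: real
    proof -
      have "2 * (\<bar>a\<bar> * \<bar>b\<bar>) \<le> a\<^sup>2 + b\<^sup>2"
        using sum_squares_bound[of "\<bar>a\<bar>" "\<bar>b\<bar>"] by (simp add: mult.assoc)
      moreover have "0 \<le> \<bar>a\<bar> * \<bar>b\<bar>" by simp
      ultimately show ?thesis unfolding abs_mult by linarith
    qed
    then show "AE z in P. norm (f z * g z) \<le> norm ((f z)\<^sup>2 + (g z)\<^sup>2)"
      by auto
  qed simp
  \<comment> \<open>The trailing factor 1 makes the mass of the box an instance of \<open>lim\<close> with \<open>h = 1\<close>.\<close>
  have ineq: "(\<Sum>z\<in>F N. measure P {z} * f z) * (\<Sum>z\<in>F N. measure P {z} * g z)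
      \<le> (\<Sum>z\<in>F N. measure P {z} * (f z * g z)) * (\<Sum>z\<in>F N. measure P {z} * 1)" for N
    unfolding F_def mult_1_right
  proof (rule FKG_finite)
    fix u v assume "u \<in> {1..n} \<rightarrow>\<^sub>E T N" "v \<in> {1..n} \<rightarrow>\<^sub>E T N"
    then show "measure P {u} * measure P {v} \<le> measure P {sup u v} * measure P {inf u v}"
      using F_sub(1)[of N] by (intro supermodular) (auto simp only: F_def)
  next
    show "mono_on ({1..n} \<rightarrow>\<^sub>E T N) f" "mono_on ({1..n} \<rightarrow>\<^sub>E T N) g"
      using mono F_sub(2)[of N] by (auto simp: F_def intro: mono_on_subset)
  qed (use finT in auto)
  have "(\<integral>z. f z \<partial>P) * (\<integral>z. g z \<partial>P) \<le> (\<integral>z. f z * g z \<partial>P) * (\<integral>z. 1 \<partial>P)"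
    by (rule LIMSEQ_le[OF tendsto_mult[OF lim[OF int(1)] lim[OF int(2)]]
          tendsto_mult[OF lim[OF int_fg] lim]]) (use ineq in auto)
  then show "(\<integral>z. f z * g z \<partial>P) \<ge> (\<integral>z. f z \<partial>P) * (\<integral>z. g z \<partial>P)"
    by (simp add: prob_space)
qed

section \<open>Path probabilities of a Markov chain\<close>

context homogeneous_markov_chain
begin

lemma measurable_path_event: "{\<omega> \<in> space M. \<forall>i\<le>k. X i \<omega> = x i} \<in> events"
  using measurable_step by measurable

text \<open>The Markov property speaks only about histories of positive probability.  A history of
  probability zero has, by induction, a vanishing factor in its product, and both facts persist
  when the path is prolonged.\<close>

lemma path_prob_eq_prod:
  assumes "x 0 = x0" "\<And>i. i \<le> k \<Longrightarrow> x i \<in> S"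
  shows "\<P>(\<omega> in M. \<forall>i\<le>k. X i \<omega> = x i) = (\<Prod>i<k. p (x i) (x (Suc i)))"
  using assms(2)
proof (induction k)
  case 0
  have "prob {\<omega> \<in> space M. X 0 \<omega> = x0} = 1"
    using start measurable_step by (subst prob_Collect_eq_1) auto
  then show ?case using assms(1) by simp
next
  case (Suc k)
  let ?Q = "\<lambda>\<omega>. \<forall>i\<le>k. X i \<omega> = x i"
  have split: "(\<forall>i\<le>Suc k. X i \<omega> = x i) \<longleftrightarrow> X (Suc k) \<omega> = x (Suc k) \<and> ?Q \<omega>" for \<omega>
    by (auto simp: le_Suc_eq)
  have IH: "\<P>(\<omega> in M. ?Q \<omega>) = (\<Prod>i<k. p (x i) (x (Suc i)))"
    using Suc by simp
  show ?case
  proof (cases "\<P>(\<omega> in M. ?Q \<omega>) > 0")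
    case True
    then have "\<P>(\<omega> in M. X (Suc k) \<omega> = x (Suc k) \<and> ?Q \<omega>)
        = p (x k) (x (Suc k)) * \<P>(\<omega> in M. ?Q \<omega>)"
      using markov[OF Suc.prems[OF order_refl] True]
      unfolding cond_prob_def
      by (subst (asm) nonzero_divide_eq_eq[OF less_imp_neq[OF True, symmetric]])
    then show ?thesis
      by (simp add: split IH mult.commute)
  next
    case False
    then have zero: "\<P>(\<omega> in M. ?Q \<omega>) = 0"
      by (simp add: zero_less_measure_iff)
    have "\<P>(\<omega> in M. X (Suc k) \<omega> = x (Suc k) \<and> ?Q \<omega>) \<le> \<P>(\<omega> in M. ?Q \<omega>)"
      using measurable_path_event by (intro finite_measure_mono) blast
    then have "\<P>(\<omega> in M. X (Suc k) \<omega> = x (Suc k) \<and> ?Q \<omega>) = 0"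
      unfolding zero measure_le_0_iff .
    moreover have "(\<Prod>i<Suc k. p (x i) (x (Suc i))) = 0"
      using zero unfolding IH by simp
    ultimately show ?thesis
      unfolding split by simp
  qed
qed

lemma path_map_measurable: "(\<lambda>\<omega>. \<lambda>k\<in>{1..n}. X k \<omega>) \<in> measurable M (Rn n)"
  unfolding Rn_def using measurable_step by (intro measurable_restrict)

text \<open>Vectors are indexed from 1 and take a default value at 0; the update at 0 puts the
  deterministic starting point in front of the path.\<close>

definition path_weight :: "nat \<Rightarrow> (nat \<Rightarrow> real) \<Rightarrow> real" where
  "path_weight n z = (\<Prod>i<n. p ((z(0 := x0)) i) (z (Suc i)))"

lemma prepend_start_in:
  fixes z :: "nat \<Rightarrow> real"
  assumes "z \<in> {1..n} \<rightarrow>\<^sub>E S" "i \<le> n"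
  shows "(z(0 := x0)) i \<in> S"
  using PiE_mem[OF assms(1), of i] assms(2) start_in by (cases "i = 0") auto

lemma path_event_prob:
  assumes "z \<in> {1..n} \<rightarrow>\<^sub>E S"
  shows "\<P>(\<omega> in M. \<forall>i\<le>n. X i \<omega> = (z(0 := x0)) i) = path_weight n z"
  using path_prob_eq_prod[of "z(0 := x0)" n] prepend_start_in[OF assms]
  by (simp add: path_weight_def)

lemma path_law_singleton:
  assumes z: "z \<in> {1..n} \<rightarrow>\<^sub>E S"
  shows "measure (path_law M X n) {z} = path_weight n z"
proof -
  have z': "z \<in> {1..n} \<rightarrow>\<^sub>E UNIV" using z by (auto simp: PiE_iff)
  have eq: "(\<lambda>k\<in>{1..n}. X k \<omega>) = z \<longleftrightarrow> (\<forall>i\<in>{1..n}. X i \<omega> = z i)" for \<omega>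
    using z by (auto simp: PiE_iff extensional_def fun_eq_iff)
  have "measure (path_law M X n) {z} = prob ((\<lambda>\<omega>. \<lambda>k\<in>{1..n}. X k \<omega>) -` {z} \<inter> space M)"
    unfolding path_law_def
    by (rule measure_distr[OF path_map_measurable singleton_in_Rn[OF z']])
  also have "\<dots> = \<P>(\<omega> in M. \<forall>i\<in>{1..n}. X i \<omega> = z i)"
    by (rule arg_cong[where f = prob])
      (auto simp only: eq vimage_def mem_Collect_eq Int_iff singleton_iff)
  also have "\<dots> = \<P>(\<omega> in M. \<forall>i\<le>n. X i \<omega> = (z(0 := x0)) i)"
  proof (rule prob_eq_AE)
    show "AE \<omega> in M. (\<forall>i\<in>{1..n}. X i \<omega> = z i) \<longleftrightarrow> (\<forall>i\<le>n. X i \<omega> = (z(0 := x0)) i)"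
      using start
    proof eventually_elim
      case (elim \<omega>)
      then show ?case by (auto simp: Suc_le_eq)
    qed
    show "{\<omega> \<in> space M. \<forall>i\<in>{1..n}. X i \<omega> = z i} \<in> events"
      using measurable_step by measurable
  qed (rule measurable_path_event)
  finally show ?thesis unfolding path_event_prob[OF z] .
qed

lemma kernel_nonneg: "x \<in> S \<Longrightarrow> y \<in> S \<Longrightarrow> 0 \<le> p x y"
  using kernel by (auto simp: transition_kernel_def)

lemma in_law_supp:
  assumes z: "z \<in> {1..n} \<rightarrow>\<^sub>E S" and pos: "path_weight n z > 0" and k: "k \<le> n"
  shows "(z(0 := x0)) k \<in> law_supp S (distr M borel (X k))"
proof -
  let ?z = "z(0 := x0)"
  have "0 < \<P>(\<omega> in M. \<forall>i\<le>n. X i \<omega> = ?z i)"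
    using pos path_event_prob[OF z] by simp
  also have "\<dots> \<le> prob (X k -` {?z k} \<inter> space M)"
    using k measurable_sets[OF measurable_step, of "{?z k}" k]
    by (intro finite_measure_mono) auto
  also have "\<dots> = measure (distr M borel (X k)) {?z k}"
    using measurable_step by (simp add: measure_distr)
  finally show ?thesis
    using prepend_start_in[OF z k] by (simp add: law_supp_def)
qed

text \<open>The inequality holds factor by factor.  The restriction of unfavorable crossings to the support
  of \<open>X\<^sub>k\<close> is harmless, since only paths \<open>u\<close> and \<open>v\<close> of positive weight have to be considered and
  \<open>in_law_supp\<close> places them there.\<close>

lemma path_weight_supermodular:
  assumes H1: "\<And>k. k < n \<Longrightarrow> unfavorable_crossings S p (law_supp S (distr M borel (X k)))"
    and u: "u \<in> {1..n} \<rightarrow>\<^sub>E S" and v: "v \<in> {1..n} \<rightarrow>\<^sub>E S"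
  shows "path_weight n u * path_weight n v \<le> path_weight n (sup u v) * path_weight n (inf u v)"
proof -
  have nonneg: "0 \<le> path_weight n z" if "z \<in> {1..n} \<rightarrow>\<^sub>E S" for z
    using path_law_singleton[OF that] by (metis measure_nonneg)
  note si = sup_inf_in_PiE_chains[OF u v]
  show ?thesis
  proof (cases "path_weight n u > 0 \<and> path_weight n v > 0")
    case True
    let ?u = "u(0 := x0)" and ?v = "v(0 := x0)"
    have step: "p (?u i) (u (Suc i)) * p (?v i) (v (Suc i))
       \<le> p (((sup u v)(0 := x0)) i) (sup u v (Suc i)) * p (((inf u v)(0 := x0)) i) (inf u v (Suc i))"
      if i: "i < n" for i
    proof -
      have *: "?u i \<in> law_supp S (distr M borel (X i))" "?v i \<in> law_supp S (distr M borel (X i))"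
        using in_law_supp[OF u, of i] in_law_supp[OF v, of i] True i by auto
      have **: "u (Suc i) \<in> S" "v (Suc i) \<in> S"
        using u v i by (auto simp: PiE_iff)
      have "((sup u v)(0 := x0)) i = max (?u i) (?v i)" "((inf u v)(0 := x0)) i = min (?u i) (?v i)"
        by (auto simp: sup_max inf_min)
      then show ?thesis
        using H1[OF i] * ** unfolding unfavorable_crossings_def by (simp add: sup_max inf_min)
    qed
    show ?thesis
      unfolding path_weight_def prod.distrib[symmetric]
      using step prepend_start_in[OF u] prepend_start_in[OF v] u v
      by (intro prod_mono conjI mult_nonneg_nonneg kernel_nonneg) (auto simp: PiE_iff start_in)
  next
    case False
    then have "path_weight n u * path_weight n v = 0"
      using nonneg[OF u] nonneg[OF v] by auto
    then show ?thesis
      using mult_nonneg_nonneg[OF nonneg[OF si(1)] nonneg[OF si(2)]] by linarith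
  qed
qed

end

section \<open>Positive association of the conditioned path\<close>

theorem theorem1p8:
  fixes n :: nat
    and M :: "'a measure"
    and S :: "real set"
    and p :: "real \<Rightarrow> real \<Rightarrow> real"
    and x0 :: real
    and X :: "nat \<Rightarrow> 'a \<Rightarrow> real"
    and A :: "(nat \<Rightarrow> real) set"
  assumes "n \<ge> 1"
    and "countable S"
    and "locally_finite_set S"
    and "homogeneous_markov_chain M S p x0 X"
    and "A \<subseteq> {1..n} \<rightarrow>\<^sub>E S"
    and H1: "\<And>k. k \<in> {0..n-1} \<Longrightarrow>
          unfavorable_crossings S p (law_supp S (distr M borel (X k)))"
    and H2: "measure (path_law M X n) A > 0" "max_min_stable A"
  shows "positively_associated n (conditional_law (path_law M X n) A)"
proof (rule FKG_locally_finite[OF _ _ assms(3)])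
  interpret homogeneous_markov_chain M S p x0 X by fact
  let ?L = "path_law M X n"
  interpret L: prob_space ?L
    unfolding path_law_def by (rule prob_space_distr[OF path_map_measurable])
  have sets_L: "sets ?L = sets (Rn n)" by (simp add: path_law_def)
  have A_pos: "emeasure ?L A \<noteq> 0" "emeasure ?L A \<noteq> \<infinity>"
    using H2(1) by (auto simp: L.emeasure_eq_measure)
  have A_meas: "A \<in> sets ?L"
    using A_pos(1) by (metis emeasure_notin_sets)
  show "prob_space (conditional_law ?L A)"
    using A_pos by (rule prob_space_uniform_measure)
  show "sets (conditional_law ?L A) = sets (Rn n)"
    by (simp add: sets_L)
  show "AE z in conditional_law ?L A. z \<in> {1..n} \<rightarrow>\<^sub>E S"
    using assms(5) by (intro AE_uniform_measureI A_meas) auto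
  have cond: "measure (conditional_law ?L A) {z} = (if z \<in> A then path_weight n z / measure ?L A else 0)"
    if z: "z \<in> {1..n} \<rightarrow>\<^sub>E S" for z
  proof -
    have "z \<in> {1..n} \<rightarrow>\<^sub>E UNIV" using z by (auto simp: PiE_iff)
    then have "{z} \<in> sets ?L" by (simp add: sets_L singleton_in_Rn)
    then show ?thesis
      using path_law_singleton[OF z] by (auto simp: measure_uniform_measure[OF A_pos])
  qed
  fix u v assume u: "u \<in> {1..n} \<rightarrow>\<^sub>E S" and v: "v \<in> {1..n} \<rightarrow>\<^sub>E S"
  note si = sup_inf_in_PiE_chains[OF u v]
  show "measure (conditional_law ?L A) {u} * measure (conditional_law ?L A) {v}
     \<le> measure (conditional_law ?L A) {sup u v} * measure (conditional_law ?L A) {inf u v}"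
  proof (cases "u \<in> A \<and> v \<in> A")
    case True
    then have "sup u v \<in> A" "inf u v \<in> A"
      using H2(2) by (auto simp: max_min_stable_def)
    moreover have "path_weight n u * path_weight n v
        \<le> path_weight n (sup u v) * path_weight n (inf u v)"
      using H1 by (intro path_weight_supermodular u v) auto
    ultimately show ?thesis
      unfolding cond[OF u] cond[OF v] cond[OF si(1)] cond[OF si(2)]
      using True by (simp add: divide_right_mono)
  next
    case False
    then have "measure (conditional_law ?L A) {u} * measure (conditional_law ?L A) {v} = 0"
      unfolding cond[OF u] cond[OF v] by auto
    then show ?thesis by (simp only: mult_nonneg_nonneg measure_nonneg)
  qed
qed

end
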